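(* Let $m,n$ be positive integers and let $\mathcal{M}\in\mathbb{R}^{[2m,n]}$ be a $T$-column sufficient tensor on $\mathbb{R}^{[m,n]}_{+}$. Then $\mathcal{M}$ is $T$-semi-positive.
   Context: Write $[n]=\{1,\dots,n\}$. $\mathbb{R}^{[m,n]}$ denotes the set of $m$-th order $n$-dimensional real tensors $\mathcal{Z}=(z_{i_1\ldots i_m})$ with $i_j\in[n]$ for $j\in[m]$, and $\mathbb{R}^{[m,n]}_{+}$ the subset of tensors with all entries nonnegative; $\mathcal{O}$ is the zero tensor. For $\mathcal{M}=(m_{i_1\ldots i_{2m}})\in\mathbb{R}^{[2m,n]}$ and $\mathcal{Z}\in\mathbb{R}^{[m,n]}$, the tensor $\mathcal{M}\mathcal{Z}\in\mathbb{R}^{[m,n]}$ is defined by $(\mathcal{M}\mathcal{Z})_{i_1\ldots i_m}=\sum_{i_{m+1},\dots,i_{2m}=1}^n m_{i_1\ldots i_m i_{m+1}\ldots i_{2m}}z_{i_{m+1}\ldots i_{2m}}$. $\mathcal{M}$ is $T$-column sufficient on $\mathbb{R}^{[m,n]}_{+}$ if for every $\mathcal{Z}\in\mathbb{R}^{[m,n]}_{+}$: if $z_{i_1\ldots i_m}(\mathcal{M}\mathcal{Z})_{i_1\ldots i_m}\le 0$ for all $i_1,\dots,i_m\in[n]$, then $z_{i_1\ldots i_m}(\mathcal{M}\mathcal{Z})_{i_1\ldots i_m}=0$ for all $i_1,\dots,i_m\in[n]$. $\mathcal{M}$ is $T$-semi-positive if for every $\mathcal{Z}\in\mathbb{R}^{[m,n]}_{+}\setminus\{\mathcal{O}\}$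 there exist $i_1,\dots,i_m\in[n]$ such that $z_{i_1\ldots i_m}>0$ and $(\mathcal{M}\mathcal{Z})_{i_1\ldots i_m}\ge 0$. *)

theory Defs
  imports Complex_Main
begin

text \<open>
  The order and the dimension of a tensor are natural numbers.  A multi-index
  \<open>(i\<^sub>1, \<dots>, i\<^sub>m)\<close> is a list of length \<open>m\<close> with entries in \<open>[n] = {1..n}\<close>, and a
  tensor assigns a real number to each multi-index.
\<close>

type_synonym tensor = "nat list \<Rightarrow> real"

definition multi_indices :: "nat \<Rightarrow> nat \<Rightarrow> nat list set" where
  "multi_indices m n = {is. length is = m \<and> set is \<subseteq> {1..n}}"

text \<open>
  Tensors take the value \<open>0\<close> outside their multi-indices, so that equality of
  functions is equality of tensors.
\<close>

definition tensors :: "nat \<Rightarrow> nat \<Rightarrow> tensor set" where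
  "tensors m n = {Z. \<forall>is. is \<notin> multi_indices m n \<longrightarrow> Z is = 0}"

definition nonneg_tensors :: "nat \<Rightarrow> nat \<Rightarrow> tensor set" where
  "nonneg_tensors m n = {Z \<in> tensors m n. \<forall>is \<in> multi_indices m n. Z is \<ge> 0}"

definition zero_tensor :: tensor where
  "zero_tensor = (\<lambda>_. 0)"

text \<open>
  For \<open>M\<close> of order \<open>2 * m\<close>, the list \<open>is @ js\<close> is the multi-index
  \<open>(i\<^sub>1, \<dots>, i\<^sub>m, i\<^sub>m\<^sub>+\<^sub>1, \<dots>, i\<^sub>2\<^sub>m)\<close>.
\<close>

definition tensor_mult :: "nat \<Rightarrow> nat \<Rightarrow> tensor \<Rightarrow> tensor \<Rightarrow> tensor" where
  "tensor_mult m n M Z =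
    (\<lambda>is. if is \<in> multi_indices m n
          then (\<Sum>js \<in> multi_indices m n. M (is @ js) * Z js) else 0)"

lemma finite_multi_indices: "finite (multi_indices m n)"
  using finite_lists_length_eq[of "{1..n}" m]
  by (simp add: multi_indices_def conj_commute)

definition T_column_sufficient_on_nonneg :: "nat \<Rightarrow> nat \<Rightarrow> tensor \<Rightarrow> bool" where
  "T_column_sufficient_on_nonneg m n M \<longleftrightarrow>
    (\<forall>Z \<in> nonneg_tensors m n.
      (\<forall>is \<in> multi_indices m n. Z is * tensor_mult m n M Z is \<le> 0) \<longrightarrow>
      (\<forall>is \<in> multi_indices m n. Z is * tensor_mult m n M Z is = 0))"

definition T_semi_positive :: "nat \<Rightarrow> nat \<Rightarrow> tensor \<Rightarrow> bool" where
  "T_semi_positive m n M \<longleftrightarrow>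
    (\<forall>Z \<in> nonneg_tensors m n - {zero_tensor}.
      \<exists>is \<in> multi_indices m n. Z is > 0 \<and> tensor_mult m n M Z is \<ge> 0)"

end

theory Submission
  imports Defs
begin

text \<open>
  A nonzero nonnegative tensor \<open>Z\<close> witnessing the failure of semi-positivity has
  \<open>M Z\<close> negative on the whole support of \<open>Z\<close>.  The entrywise products of \<open>Z\<close> and
  \<open>M Z\<close> are then nonpositive everywhere and negative on the support, which is
  nonempty; column sufficiency forbids exactly this.
\<close>

theorem theorem4p4:
  fixes m n :: nat and M :: tensor
  assumes "m \<ge> 1" and "n \<ge> 1"
    and "M \<in> tensors (2 * m) n"
    and "T_column_sufficient_on_nonneg m n M"
  shows "T_semi_positive m n M"
proof (rule ccontr)
  let ?I = "multi_indices m n"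
  assume "\<not> T_semi_positive m n M"
  then obtain Z where Z: "Z \<in> nonneg_tensors m n" "Z \<noteq> zero_tensor"
    and neg: "\<And>is. is \<in> ?I \<Longrightarrow> Z is > 0 \<Longrightarrow> tensor_mult m n M Z is < 0"
    unfolding T_semi_positive_def by force
  have nonneg: "Z is \<ge> 0" if "is \<in> ?I" for "is"
    using Z(1) that by (simp add: nonneg_tensors_def)
  have "Z is * tensor_mult m n M Z is \<le> 0" if "is \<in> ?I" for "is"
    using nonneg[OF that] neg[OF that]
    by (cases "Z is = 0") (auto simp: mult_le_0_iff)
  then have zero: "Z is * tensor_mult m n M Z is = 0" if "is \<in> ?I" for "is"
    using assms(4) Z(1) that unfolding T_column_sufficient_on_nonneg_def by blast
  obtain js where "Z js \<noteq> 0"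
    using Z(2) by (auto simp: zero_tensor_def)
  \<comment> \<open>Tensors vanish off their multi-indices, so \<open>js\<close> is a genuine multi-index.\<close>
  then have js: "js \<in> ?I"
    using Z(1) by (auto simp: nonneg_tensors_def tensors_def)
  then have "Z js > 0"
    using nonneg \<open>Z js \<noteq> 0\<close> by (simp add: order_less_le)
  with js neg zero show False by fastforce
qed

end
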